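(* Let $q$ be a prime power, let $t \geq 2$, and let $f(x) = c_1 x^{a_1} + \cdots + c_t x^{a_t} \in \mathbb{F}_q[x]$ with nonzero coefficients $c_i$ and nonnegative integer exponents $a_i$. Define $$\delta(f) = \gcd(a_1, a_2, \ldots, a_t, q-1),$$ $$D(f) = \min_{1 \le i \le t} \ \max_{j \neq i} \ \gcd(a_i - a_j, q-1),$$ $$Q(f) = \gcd_{1 \le i \le t} \ \Bigl( \operatorname{lcm}_{j \neq i} \ \gcd(a_i - a_j, q-1) \Bigr),$$ $$K(f) = \min_{1 \le i \le t} \ \max_{j \neq i} \ \gcd(a_i - a_j, Q(f)),$$ and $$S(f) = \{\, k \in \mathbb{N} : k \mid (q-1), \text{ and for all } i \in \{1,\dots,t\} \text{ there is a } j \neq i \text{ with } a_i \equiv a_j \pmod{k} \,\}.$$ Then: (1) $\delta(f) \in S(f)$. (2) For all $k \in S(f)$, $k \mid Q(f)$. (3) $D(f)$, $Q(f)$ and $K(f)$ are all upper bounds for $S(f)$ (that is, every $k \in S(f)$ satisfies $k \le D(f)$, $k \le Q(f)$ and $k \le K(f)$), and $K(f) \leq \min(D(f), Q(f))$.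
   Context: $\mathbb{F}_q$ is the finite field with $q$ elements. The index $j$ always ranges over $\{1,\dots,t\}$. In the definition of $Q(f)$, the outer gcd is taken over all $i \in \{1,\dots,t\}$ and, for each fixed $i$, the inner lcm is taken over all $j \in \{1,\dots,t\}$ with $j \neq i$. All gcd's are taken to be positive. *)

theory Defs
  imports
    "HOL-Computational_Algebra.Polynomial"
    "HOL-Number_Theory.Cong"
begin

text \<open>
  All quantities attached to \<open>f = c\<^sub>1 x\<^bsup>a\<^sub>1\<^esup> + \<dots> + c\<^sub>t x\<^bsup>a\<^sub>t\<^esup>\<close> over the field with \<open>q\<close> elements
  depend only on \<open>q\<close>, the number \<open>t\<close> of terms and the exponents \<open>a 1, \<dots>, a t\<close>.
  Values of \<open>a\<close> outside \<open>{1..t}\<close> are irrelevant. Since \<open>q \<ge> 2\<close>, the natural number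
  \<open>q - 1\<close> involves no truncation.
\<close>

text \<open>
  The difference of exponents is taken in the integers; the positive gcd is then
  returned as a natural number.
\<close>

definition gcd_diff :: "(nat \<Rightarrow> nat) \<Rightarrow> nat \<Rightarrow> nat \<Rightarrow> nat \<Rightarrow> nat" where
  "gcd_diff a i j m = nat (gcd (int (a i) - int (a j)) (int m))"

definition delta_f :: "nat \<Rightarrow> nat \<Rightarrow> (nat \<Rightarrow> nat) \<Rightarrow> nat" where
  "delta_f q t a = gcd (GCD i\<in>{1..t}. a i) (q - 1)"

definition D_f :: "nat \<Rightarrow> nat \<Rightarrow> (nat \<Rightarrow> nat) \<Rightarrow> nat" where
  "D_f q t a = (MIN i\<in>{1..t}. MAX j\<in>{1..t} - {i}. gcd_diff a i j (q - 1))"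

definition Q_f :: "nat \<Rightarrow> nat \<Rightarrow> (nat \<Rightarrow> nat) \<Rightarrow> nat" where
  "Q_f q t a = (GCD i\<in>{1..t}. LCM j\<in>{1..t} - {i}. gcd_diff a i j (q - 1))"

definition K_f :: "nat \<Rightarrow> nat \<Rightarrow> (nat \<Rightarrow> nat) \<Rightarrow> nat" where
  "K_f q t a = (MIN i\<in>{1..t}. MAX j\<in>{1..t} - {i}. gcd_diff a i j (Q_f q t a))"

definition S_f :: "nat \<Rightarrow> nat \<Rightarrow> (nat \<Rightarrow> nat) \<Rightarrow> nat set" where
  "S_f q t a =
     {k. k dvd q - 1 \<and> (\<forall>i\<in>{1..t}. \<exists>j\<in>{1..t} - {i}. [a i = a j] (mod k))}"

end

theory Submission
  imports Defs
begin

text \<open>A number \<open>k\<close> divides \<open>gcd_diff a i j m\<close> exactly when it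
  divides \<open>m\<close> and \<open>a i\<close>, \<open>a j\<close> agree modulo \<open>k\<close>
  (\<open>dvd_gcd_diff_iff\<close>). Hence k in S(f) provides, for each i, some j \<noteq> i with k
  dividing gcd(a_i - a_j, q-1), so k divides every inner lcm and therefore Q(f)
  (\<open>dvd_Q_f\<close>). The same j then also gives that k divides gcd(a_i - a_j, Q(f)). As all
  moduli are positive, divisibility becomes \<le>, which bounds k by D(f) and by K(f)
  (\<open>S_f_le_Min_Max\<close>). Since Q(f) divides q-1 (\<open>Q_f_dvd\<close>), replacing q-1 by
  Q(f) can only shrink the gcd's, so K(f) \<le> D(f); and each gcd with Q(f) is at most
  Q(f).\<close>

lemma dvd_gcd_diff_iff:
  "k dvd gcd_diff a i j m \<longleftrightarrow> [a i = a j] (mod k) \<and> k dvd m"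
proof -
  have "k dvd gcd_diff a i j m \<longleftrightarrow> int k dvd gcd (int (a i) - int (a j)) (int m)"
    unfolding gcd_diff_def by (simp flip: int_dvd_int_iff)
  also have "\<dots> \<longleftrightarrow> [a i = a j] (mod k) \<and> k dvd m"
    unfolding gcd_greatest_iff int_dvd_int_iff cong_iff_dvd_diff [symmetric] cong_int_iff ..
  finally show ?thesis .
qed

lemma gcd_diff_dvd: "gcd_diff a i j m dvd m"
  using dvd_gcd_diff_iff [of "gcd_diff a i j m" a i j m] by simp

lemma gcd_diff_pos: "m > 0 \<Longrightarrow> gcd_diff a i j m > 0"
  by (rule dvd_pos_nat [OF _ gcd_diff_dvd])

lemma gcd_diff_le:
  assumes "m dvd n" "n > 0"
  shows "gcd_diff a i j m \<le> gcd_diff a i j n"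
proof (rule dvd_imp_le)
  show "gcd_diff a i j m dvd gcd_diff a i j n"
    \<comment> \<open>The smaller gcd is itself taken as the divisor \<open>k\<close> in the
      characterisation.\<close>
    using dvd_gcd_diff_iff [of "gcd_diff a i j m" a i j m] dvd_trans [OF _ assms(1)]
    by (simp add: dvd_gcd_diff_iff)
qed (use assms(2) in \<open>rule gcd_diff_pos\<close>)

text \<open>Gives lower bounds on D(f) and K(f) the for-all-exists shape of the condition defining
  S(f). The nonemptiness assumptions keep \<open>Min\<close> and \<open>Max\<close>
  meaningful.\<close>

lemma le_Min_Max_iff:
  fixes g :: "'i \<Rightarrow> 'i \<Rightarrow> 'b :: linorder"
  assumes "finite I" "I \<noteq> {}" "\<And>i. i \<in> I \<Longrightarrow> I - {i} \<noteq> {}"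
  shows "k \<le> (MIN i\<in>I. MAX j\<in>I - {i}. g i j) \<longleftrightarrow> (\<forall>i\<in>I. \<exists>j\<in>I - {i}. k \<le> g i j)"
proof -
  have "k \<le> (MAX j\<in>I - {i}. g i j) \<longleftrightarrow> (\<exists>j\<in>I - {i}. k \<le> g i j)" if "i \<in> I" for i
    using assms that by (subst Max_ge_iff) auto
  then show ?thesis
    using assms by (subst Min_ge_iff) auto
qed

lemma Q_f_dvd:
  assumes "t > 0"
  shows "Q_f q t a dvd q - 1"
proof -
  have "Q_f q t a dvd (LCM j\<in>{1..t} - {1}. gcd_diff a 1 j (q - 1))"
    unfolding Q_f_def using assms by (intro Gcd_dvd imageI) simp
  also have "\<dots> dvd q - 1"
    by (intro Lcm_least) (auto intro: gcd_diff_dvd)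
  finally show ?thesis .
qed

lemma dvd_Q_f:
  assumes "k \<in> S_f q t a"
  shows "k dvd Q_f q t a"
  unfolding Q_f_def
proof (rule Gcd_greatest, clarify)
  fix i assume "i \<in> {1..t}"
  with assms obtain j where "j \<in> {1..t} - {i}" "k dvd gcd_diff a i j (q - 1)"
    unfolding S_f_def dvd_gcd_diff_iff by blast
  then show "k dvd (LCM j\<in>{1..t} - {i}. gcd_diff a i j (q - 1))"
    by (intro dvd_trans [OF _ dvd_Lcm, of k "gcd_diff a i j (q - 1)"] imageI)
qed

text \<open>Stated for a general modulus \<open>m\<close> so as to cover both D(f), with m = q-1,
  and K(f), with m = Q(f).\<close>

lemma S_f_le_Min_Max:
  assumes "k \<in> S_f q t a" "k dvd m" "m > 0"
    and "t > 0" "\<And>i. i \<in> {1..t} \<Longrightarrow> {1..t} - {i} \<noteq> {}"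
  shows "k \<le> (MIN i\<in>{1..t}. MAX j\<in>{1..t} - {i}. gcd_diff a i j m)"
proof (subst le_Min_Max_iff, goal_cases)
  case 4
  show ?case
  proof
    fix i assume "i \<in> {1..t}"
    with assms(1,2) obtain j where "j \<in> {1..t} - {i}" "k dvd gcd_diff a i j m"
      unfolding S_f_def dvd_gcd_diff_iff by blast
    then show "\<exists>j\<in>{1..t} - {i}. k \<le> gcd_diff a i j m"
      by (intro bexI [of _ j] dvd_imp_le gcd_diff_pos [OF assms(3)])
  qed
qed (use assms in auto)

lemma delta_f_in_S_f:
  assumes "\<And>i. i \<in> {1..t} \<Longrightarrow> {1..t} - {i} \<noteq> {}"
  shows "delta_f q t a \<in> S_f q t a"
proof -
  have "delta_f q t a dvd a i" if "i \<in> {1..t}" for i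
    unfolding delta_f_def using that by (intro dvd_trans [OF gcd_dvd1 Gcd_dvd] imageI)
  \<comment> \<open>Both exponents are 0 modulo \<open>delta_f q t a\<close>, so any j \<noteq> i is
    a witness.\<close>
  then have "[a i = a j] (mod delta_f q t a)" if "i \<in> {1..t}" "j \<in> {1..t}" for i j
    using that by (simp add: cong_def mod_eq_0_iff_dvd)
  moreover have "delta_f q t a dvd q - 1"
    unfolding delta_f_def by (rule gcd_dvd2)
  ultimately show ?thesis
    using assms unfolding S_f_def by blast
qed

theorem proposition2p4:
  fixes f :: "'a :: {finite, field} poly"
    and c :: "nat \<Rightarrow> 'a" and a :: "nat \<Rightarrow> nat" and t q :: nat
  assumes q: "q = card (UNIV :: 'a set)"
    and t: "t \<ge> 2"
    and f: "f = (\<Sum>i=1..t. monom (c i) (a i))"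
    and c: "\<forall>i\<in>{1..t}. c i \<noteq> 0"
  shows "delta_f q t a \<in> S_f q t a \<and>
    (\<forall>k\<in>S_f q t a. k dvd Q_f q t a) \<and>
    (\<forall>k\<in>S_f q t a. k \<le> D_f q t a \<and> k \<le> Q_f q t a \<and> k \<le> K_f q t a) \<and>
    K_f q t a \<le> min (D_f q t a) (Q_f q t a)"
proof -
  \<comment> \<open>A field has 0 \<noteq> 1, so q-1 is positive; its divisor Q(f) then is
    too.\<close>
  have "card {0, 1 :: 'a} \<le> q"
    unfolding q by (rule card_mono) auto
  then have q1: "q - 1 > 0" by simp
  have t0: "t > 0" using t by simp
  have Q_dvd: "Q_f q t a dvd q - 1" using t0 by (rule Q_f_dvd)
  then have Q_pos: "Q_f q t a > 0" by (rule dvd_pos_nat [OF q1])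
  have others: "{1..t} - {i} \<noteq> {}" for i
  proof -
    have "(if i = 1 then 2 else 1) \<in> {1..t} - {i}" using t by auto
    then show ?thesis by blast
  qed
  have iff: "k \<le> (MIN i\<in>{1..t}. MAX j\<in>{1..t} - {i}. g i j) \<longleftrightarrow>
      (\<forall>i\<in>{1..t}. \<exists>j\<in>{1..t} - {i}. k \<le> g i j)" for k :: nat and g
    using t0 others by (intro le_Min_Max_iff) auto
  \<comment> \<open>This is K(f) \<le> K(f) read through \<open>iff\<close>; both bounds on K(f)
    come from it.\<close>
  have K: "\<forall>i\<in>{1..t}. \<exists>j\<in>{1..t} - {i}. K_f q t a \<le> gcd_diff a i j (Q_f q t a)"
    by (rule iffD1 [OF iff]) (simp add: K_f_def)
  have "K_f q t a \<le> D_f q t a"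
    unfolding D_f_def iff using K gcd_diff_le[OF Q_dvd q1] order_trans by blast
  moreover have "K_f q t a \<le> Q_f q t a"
  proof -
    from K t0 obtain j where "K_f q t a \<le> gcd_diff a 1 j (Q_f q t a)" by force
    also have "\<dots> \<le> Q_f q t a" using gcd_diff_dvd Q_pos by (rule dvd_imp_le)
    finally show ?thesis .
  qed
  moreover have "k \<le> D_f q t a" if "k \<in> S_f q t a" for k
    unfolding D_f_def using that q1 t0 others
    by (intro S_f_le_Min_Max) (auto simp: S_f_def)
  moreover have "k \<le> K_f q t a" if "k \<in> S_f q t a" for k
    unfolding K_f_def using that dvd_Q_f[OF that] Q_pos t0 others by (rule S_f_le_Min_Max)
  ultimately show ?thesis
    using delta_f_in_S_f[OF others] dvd_Q_f dvd_imp_le[OF _ Q_pos] by simp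
qed

end
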